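(* Let $k\ge 2$ and let $G$ be a minimally $k$-connected graph with $n$ vertices and $m$ edges. Then $$|V_k|=\frac{m-n+c_F+|E_k|}{k-1}.$$ In particular, $$|V_k|\ge\left\lceil\frac{m-n+k}{k-1}\right\rceil.$$
   Context: All graphs are finite, simple and undirected. A $k$-separator is a set of $k\ge 0$ vertices whose deletion leaves a disconnected graph. A graph is $k$-connected if it has more than $k$ vertices and contains no $(k-1)$-separator. A $k$-connected graph $G$ is minimally $k$-connected if $G-e$ is not $k$-connected for every edge $e$. For a graph $G$: $V_k$ is the set of vertices of degree exactly $k$; $E_k$ is the set of edges of $G$ with both end vertices in $V_k$; $F:=G-V_k$ is the graph obtained by deleting $V_k$; and $c_F$ is the number of connected components of $F$. *)

theory Defs
  imports Complex_Main
begin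

text \<open>A finite simple graph: a finite vertex set V and a set E of edges,
  each edge being a 2-element subset of V.\<close>
definition simple_graph :: "'a set \<Rightarrow> 'a set set \<Rightarrow> bool" where
  "simple_graph V E \<longleftrightarrow> finite V \<and>
     (\<forall>e\<in>E. \<exists>u v. e = {u, v} \<and> u \<noteq> v \<and> u \<in> V \<and> v \<in> V)"

definition degree :: "'a set set \<Rightarrow> 'a \<Rightarrow> nat" where
  "degree E v = card {e\<in>E. v \<in> e}"

text \<open>Adjacency relation of the subgraph induced by S.\<close>
definition adj_in :: "'a set \<Rightarrow> 'a set set \<Rightarrow> ('a \<times> 'a) set" where
  "adj_in S E = {(u, v). u \<in> S \<and> v \<in> S \<and> {u, v} \<in> E}"

text \<open>The subgraph of (V,E) induced by S is connected.\<close>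
definition connected_in :: "'a set \<Rightarrow> 'a set set \<Rightarrow> bool" where
  "connected_in S E \<longleftrightarrow> (\<forall>u\<in>S. \<forall>v\<in>S. (u, v) \<in> (adj_in S E)\<^sup>*)"

text \<open>Connected components of the subgraph induced by S.\<close>
definition components_in :: "'a set \<Rightarrow> 'a set set \<Rightarrow> 'a set set" where
  "components_in S E = S // ((adj_in S E)\<^sup>*)"

text \<open>A k-separator: k vertices whose deletion leaves a disconnected graph.\<close>
definition separator :: "'a set \<Rightarrow> 'a set set \<Rightarrow> 'a set \<Rightarrow> bool" where
  "separator V E S \<longleftrightarrow> S \<subseteq> V \<and> \<not> connected_in (V - S) E"

definition k_connected :: "nat \<Rightarrow> 'a set \<Rightarrow> 'a set set \<Rightarrow> bool" where
  "k_connected k V E \<longleftrightarrow> card V > k \<and>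
     \<not> (\<exists>S. separator V E S \<and> card S = k - 1)"

definition minimally_k_connected :: "nat \<Rightarrow> 'a set \<Rightarrow> 'a set set \<Rightarrow> bool" where
  "minimally_k_connected k V E \<longleftrightarrow> k_connected k V E \<and>
     (\<forall>e\<in>E. \<not> k_connected k V (E - {e}))"

definition Vdeg :: "nat \<Rightarrow> 'a set \<Rightarrow> 'a set set \<Rightarrow> 'a set" where
  "Vdeg k V E = {v\<in>V. degree E v = k}"

definition Edeg :: "nat \<Rightarrow> 'a set \<Rightarrow> 'a set set \<Rightarrow> 'a set set" where
  "Edeg k V E = {e\<in>E. e \<subseteq> Vdeg k V E}"

text \<open>c_F: number of components of F = G - V_k.\<close>
definition cF :: "nat \<Rightarrow> 'a set \<Rightarrow> 'a set set \<Rightarrow> nat" where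
  "cF k V E = card (components_in (V - Vdeg k V E) E)"

end

theory Submission
  imports Defs
begin

text \<open>
  Deleting an edge \<open>xy\<close> of a minimally \<open>k\<close>-connected graph creates a separator \<open>S\<close> of size \<open>k - 1\<close>
  with sides \<open>A\<close> and \<open>B\<close> joined only by \<open>xy\<close>. Uncrossing the separations of two edges that meet in
  a vertex of degree greater than \<open>k\<close> shows that the far sides shrink strictly along paths of such
  vertices. Hence \<open>F = G - V\<^sub>k\<close> is a forest (Mader), and counting edges gives the formula.

  The lower bound amounts to \<open>k \<le> c\<^sub>F + |E\<^sub>k|\<close>. If some \<open>v\<close> in \<open>V\<^sub>k\<close> has at most one neighbour in each
  component of \<open>F\<close>, then it has at least \<open>k - c\<^sub>F\<close> neighbours in \<open>V\<^sub>k\<close>. Such a vertex is found in a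
  smallest side \<open>B\<close> of all separations of edges of \<open>F\<close>: either every edge of \<open>F\<close> has a separator
  missing \<open>B\<close> up to one vertex of \<open>F\<close>, or \<open>2|B| \<le> k\<close>. In the latter case enough edges of \<open>E\<^sub>k\<close> are
  incident with \<open>B\<close>.
\<close>

section \<open>Counting components of a forest\<close>

lemma sym_adj_in: "sym (adj_in S E)"
  by (auto simp: sym_def adj_in_def insert_commute)

lemma adj_in_rtrancl_sym: "(u, v) \<in> (adj_in S E)\<^sup>* \<Longrightarrow> (v, u) \<in> (adj_in S E)\<^sup>*"
  using sym_rtrancl[OF sym_adj_in] by (rule symD)

lemma adj_in_rtrancl_closed:
  "(u, v) \<in> (adj_in S E)\<^sup>* \<Longrightarrow> u \<in> S \<Longrightarrow> v \<in> S"
  by (induction rule: rtrancl_induct) (auto simp: adj_in_def)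

lemma adj_in_rtrancl_mono:
  "(u, v) \<in> (adj_in S E)\<^sup>* \<Longrightarrow> E \<subseteq> E' \<Longrightarrow> (u, v) \<in> (adj_in S E')\<^sup>*"
  by (rule subsetD[OF rtrancl_mono]) (auto simp: adj_in_def)

lemma finite_components_in: "finite S \<Longrightarrow> finite (components_in S E)"
  by (simp add: components_in_def quotient_def)

text \<open>The classes of \<open>u\<close> and \<open>v\<close> are two distinct old components
  that fuse into their union \<open>?U\<close>; every other class survives.\<close>

lemma components_in_insert_edge:
  assumes "finite S" "u \<in> S" "v \<in> S" "(u, v) \<notin> (adj_in S E)\<^sup>*"
  shows "Suc (card (components_in S (insert {u, v} E))) = card (components_in S E)"
proof -
  define R where "R = (adj_in S E)\<^sup>*"
  define R' where "R' = (adj_in S (insert {u, v} E))\<^sup>*"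
  have sym: "(b, a) \<in> R" if "(a, b) \<in> R" for a b
    using that adj_in_rtrancl_sym unfolding R_def by fast
  have trans: "(a, c) \<in> R" if "(a, b) \<in> R" "(b, c) \<in> R" for a b c
    using that unfolding R_def by (rule rtrancl_trans)
  have refl: "(a, a) \<in> R" for a by (simp add: R_def)
  have uv: "(u, v) \<notin> R" using assms by (simp add: R_def)
  have ins: "adj_in S (insert {u, v} E) = insert (u, v) (insert (v, u) (adj_in S E))"
    using assms by (auto simp: adj_in_def doubleton_eq_iff)
  have R': "(a, b) \<in> R' \<longleftrightarrow> (a, b) \<in> R
      \<or> (a \<in> R``{u} \<union> R``{v} \<and> b \<in> R``{u} \<union> R``{v})" for a b
    unfolding R'_def ins rtrancl_insert R_def[symmetric] using sym trans refl by blast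
  let ?U = "R``{u} \<union> R``{v}"
  let ?C = "components_in S E - {R``{u}, R``{v}}"
  have eqv: "R``{a} = R``{b}" if "(a, b) \<in> R" for a b using that sym trans by blast
  have cls: "R'``{w} = (if w \<in> ?U then ?U else R``{w})" for w
  proof (rule set_eqI)
    fix b
    show "b \<in> R'``{w} \<longleftrightarrow> b \<in> (if w \<in> ?U then ?U else R``{w})"
    proof (cases "w \<in> ?U")
      case True
      then have "b \<in> ?U" if "(w, b) \<in> R" using that trans by blast
      then show ?thesis using True R'[of w b] by auto
    next
      case False then show ?thesis using R'[of w b] by simp
    qed
  qed
  have "components_in S (insert {u, v} E) = insert ?U ?C"
  proof (intro set_eqI iffI)
    fix X assume "X \<in> components_in S (insert {u, v} E)"
    then obtain w where w: "w \<in> S" "X = R'``{w}"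
      unfolding components_in_def quotient_def R'_def by blast
    show "X \<in> insert ?U ?C"
    proof (cases "w \<in> ?U")
      case True then show ?thesis using w cls by simp
    next
      case False
      then have "X = R``{w}" using w cls by simp
      moreover have "R``{w} \<noteq> R``{u}" "R``{w} \<noteq> R``{v}" using False refl by blast+
      ultimately show ?thesis using w
        unfolding components_in_def quotient_def R_def by blast
    qed
  next
    fix X assume X: "X \<in> insert ?U ?C"
    show "X \<in> components_in S (insert {u, v} E)"
    proof (cases "X = ?U")
      case True
      then have "X = R'``{u}" using cls refl by simp
      then show ?thesis using assms unfolding components_in_def quotient_def R'_def by blast
    next
      case False
      then obtain w where w: "w \<in> S" "X = R``{w}" "X \<noteq> R``{u}" "X \<noteq> R``{v}"
        using X unfolding components_in_def quotient_def R_def by blast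
      then have "w \<notin> ?U" using eqv by blast
      then have "X = R'``{w}" using cls w by simp
      then show ?thesis using w unfolding components_in_def quotient_def R'_def by blast
    qed
  qed
  moreover have "?U \<notin> ?C"
  proof
    assume "?U \<in> ?C"
    then obtain w where w: "?U = R``{w}" "R``{w} \<noteq> R``{u}"
      unfolding components_in_def quotient_def R_def by blast
    then have "(w, u) \<in> R" using refl by blast
    then show False using eqv w by blast
  qed
  moreover have "{R``{u}, R``{v}} \<subseteq> components_in S E"
    using assms unfolding components_in_def quotient_def R_def by blast
  moreover have "R``{u} \<noteq> R``{v}" using uv refl by blast
  moreover have fin: "finite (components_in S E)" using assms finite_components_in by blast
  \<comment> \<open>\<open>card_mono\<close> supplies that there are at least two components, so the
    subtraction of naturals is exact.\<close>
  ultimately show ?thesis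
    using card_mono[OF fin, of "{R``{u}, R``{v}}"] by (simp add: card_Diff_subset)
qed

text \<open>Acyclicity is expressed by saying that each edge is a bridge. Starting from
  \<open>card S\<close> singletons, every inserted edge then lowers the number of components by
  one.\<close>

lemma forest_card:
  assumes "finite E" "finite S"
    and "\<And>e. e \<in> E \<Longrightarrow> \<exists>u v. e = {u, v} \<and> u \<in> S \<and> v \<in> S"
    and "\<And>u v. {u, v} \<in> E \<Longrightarrow> (u, v) \<notin> (adj_in S (E - {{u, v}}))\<^sup>*"
  shows "card E + card (components_in S E) = card S"
  using assms(1,3,4)
proof (induction E rule: finite_induct)
  case empty
  have "components_in S {} = (\<lambda>x. {x}) ` S"
    by (auto simp: components_in_def quotient_def adj_in_def)
  then show ?case by (simp add: card_image)
next
  case (insert e E)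
  obtain u v where uv: "e = {u, v}" "u \<in> S" "v \<in> S" using insert.prems(1) by blast
  have "(u, v) \<notin> (adj_in S E)\<^sup>*"
    using insert.prems(2)[of u v] insert.hyps uv by simp
  then have "Suc (card (components_in S (insert e E))) = card (components_in S E)"
    using components_in_insert_edge assms(2) uv by metis
  moreover have "card E + card (components_in S E) = card S"
  proof (rule insert.IH)
    show "\<exists>u v. f = {u, v} \<and> u \<in> S \<and> v \<in> S" if "f \<in> E" for f
      using insert.prems(1) that by blast
    show "(a, b) \<notin> (adj_in S (E - {{a, b}}))\<^sup>*" if "{a, b} \<in> E" for a b
      using insert.prems(2)[of a b] that
        adj_in_rtrancl_mono[of a b S "E - {{a, b}}" "insert e E - {{a, b}}"] by blast
  qed
  ultimately show ?case using insert.hyps by simp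
qed

lemma card_le_components:
  assumes "finite S" "W \<subseteq> S"
    and "\<And>a b. a \<in> W \<Longrightarrow> b \<in> W \<Longrightarrow> (a, b) \<in> (adj_in S E)\<^sup>* \<Longrightarrow> a = b"
  shows "card W \<le> card (components_in S E)"
proof (rule card_inj_on_le)
  show "inj_on (\<lambda>w. (adj_in S E)\<^sup>* `` {w}) W"
    using assms(3) by (auto intro!: inj_onI)
  show "(\<lambda>w. (adj_in S E)\<^sup>* `` {w}) ` W \<subseteq> components_in S E"
    using assms(2) by (auto simp: components_in_def quotient_def)
qed (use assms finite_components_in in blast)

text \<open>Cut a walk at its last visit to the starting point.\<close>

lemma rtrancl_last_departure:
  assumes "(y, x) \<in> R\<^sup>*" "x \<noteq> y"
  shows "\<exists>z. (y, z) \<in> R \<and> z \<noteq> y \<and> (z, x) \<in> (R \<inter> (- {y}) \<times> (- {y}))\<^sup>*"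
  using assms
proof (induction rule: rtrancl_induct)
  case (step x x')
  show ?case
  proof (cases "x = y")
    case True then show ?thesis using step by blast
  next
    case False
    then obtain z where "(y, z) \<in> R" "z \<noteq> y" "(z, x) \<in> (R \<inter> (- {y}) \<times> (- {y}))\<^sup>*"
      using step by blast
    moreover have "(x, x') \<in> R \<inter> (- {y}) \<times> (- {y})" using False step by blast
    ultimately show ?thesis by (meson rtrancl.rtrancl_into_rtrancl)
  qed
qed simp

text \<open>A walk missing \<open>y\<close> survives the deletion of any edge at \<open>y\<close>.
  This is meant for the tail produced by \<open>rtrancl_last_departure\<close>.\<close>

lemma adj_in_rtrancl_avoiding:
  assumes "(z, w) \<in> (adj_in S E' \<inter> (- {y}) \<times> (- {y}))\<^sup>*" "E' \<subseteq> E"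
  shows "(z, w) \<in> (adj_in S (E - {{y, t}}))\<^sup>*"
proof -
  have "adj_in S E' \<inter> (- {y}) \<times> (- {y}) \<subseteq> adj_in S (E - {{y, t}})"
    using assms(2) by (auto simp: adj_in_def)
  from subsetD[OF rtrancl_mono[OF this] assms(1)] show ?thesis .
qed

section \<open>Separations across an edge\<close>

locale minimally_k_connected_graph =
  fixes V :: "'a set" and E :: "'a set set" and k :: nat
  assumes simple: "simple_graph V E"
    and k2: "k \<ge> 2"
    and minimal: "minimally_k_connected k V E"
begin

lemma finite_V: "finite V"
  using simple by (simp add: simple_graph_def)

lemma edgeE:
  assumes "e \<in> E"
  obtains u v where "e = {u, v}" "u \<noteq> v" "u \<in> V" "v \<in> V"
  using simple assms unfolding simple_graph_def by blast

lemma edge_in_V: "{u, v} \<in> E \<Longrightarrow> u \<in> V \<and> v \<in> V \<and> u \<noteq> v"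
  by (erule edgeE) (auto simp: doubleton_eq_iff)

lemma finite_E: "finite E"
  by (rule finite_subset[of _ "Pow V"]) (use finite_V in \<open>auto elim!: edgeE\<close>)

lemma card_V: "card V > k"
  using minimal by (simp add: minimally_k_connected_def k_connected_def)

definition nbrs :: "'a \<Rightarrow> 'a set" where
  "nbrs v = {w. {v, w} \<in> E}"

lemma nbrs_subset: "nbrs v \<subseteq> V - {v}"
  using edge_in_V by (auto simp: nbrs_def)

lemma finite_nbrs: "finite (nbrs v)"
  using finite_subset[OF nbrs_subset] finite_V by blast

lemma degree_eq_card_nbrs: "degree E v = card (nbrs v)"
proof -
  have "{e \<in> E. v \<in> e} = (\<lambda>w. {v, w}) ` nbrs v"
  proof (intro set_eqI iffI)
    fix e assume "e \<in> {e \<in> E. v \<in> e}"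
    then have e: "e \<in> E" "v \<in> e" by simp_all
    from e(1) obtain u w where uw: "e = {u, w}" by (rule edgeE)
    then show "e \<in> (\<lambda>w. {v, w}) ` nbrs v"
      using e by (auto simp: nbrs_def insert_commute)
  qed (auto simp: nbrs_def)
  moreover have "inj_on (\<lambda>w. {v, w}) (nbrs v)"
    by (auto simp: inj_on_def doubleton_eq_iff)
  ultimately show ?thesis by (simp add: degree_def card_image)
qed

text \<open>A separating set of fewer than \<open>k - 1\<close> vertices can be enlarged to a
  \<open>(k - 1)\<close>-separator, so \<open>k\<close>-connectedness excludes all smaller separators too.\<close>

lemma card_boundary_ge:
  assumes X: "X \<subseteq> V" "X \<noteq> {}" and N: "N \<subseteq> V" and r: "r \<in> V" "r \<notin> X" "r \<notin> N"
    and no: "\<And>u w. u \<in> X \<Longrightarrow> u \<notin> N \<Longrightarrow> w \<in> V \<Longrightarrow> w \<notin> X \<Longrightarrow> w \<notin> N \<Longrightarrow> {u, w} \<notin> E"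
    and disj: "X \<inter> N = {}"
  shows "k \<le> card N"
proof (rule ccontr)
  assume "\<not> k \<le> card N"
  then have small: "card N \<le> k - 1" by simp
  obtain x where x: "x \<in> X" using X by blast
  \<comment> \<open>Room for enlarging \<open>N\<close> to exactly \<open>k - 1\<close> vertices
    without touching \<open>x\<close> and \<open>r\<close>.\<close>
  have "card (V - {x, r}) = card V - 2"
    using x X r finite_V by (subst card_Diff_subset) (auto simp: card_insert_if)
  then have big: "k - 1 \<le> card (V - {x, r})" using card_V by simp
  have "N \<subseteq> V - {x, r}" using N x r disj by blast
  then obtain S where S: "N \<subseteq> S" "S \<subseteq> V - {x, r}" "card S = k - 1"
    using exists_subset_between[OF small big] finite_V by blast
  have "(x, v) \<in> (adj_in (V - S) E)\<^sup>* \<Longrightarrow> v \<in> X" for v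
  proof (induction rule: rtrancl_induct)
    case (step v w) then show ?case using no S disj by (auto simp: adj_in_def)
  qed (use x in simp)
  then have "(x, r) \<notin> (adj_in (V - S) E)\<^sup>*" using r by blast
  then have "\<not> connected_in (V - S) E"
    using S x r X unfolding connected_in_def by blast
  then have "separator V E S" using S by (auto simp: separator_def)
  then show False
    using minimal S unfolding minimally_k_connected_def k_connected_def by blast
qed

text \<open>With fewer than \<open>k\<close> neighbours some vertex \<open>r\<close> is neither
  \<open>v\<close> nor adjacent to it, and \<open>nbrs v\<close> would separate the two.\<close>

lemma degree_ge:
  assumes "v \<in> V"
  shows "k \<le> degree E v"
proof (rule ccontr)
  assume "\<not> k \<le> degree E v"
  then have small: "card (insert v (nbrs v)) \<le> k"
    using degree_eq_card_nbrs finite_nbrs by (simp add: card_insert_if)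
  have "\<not> V \<subseteq> insert v (nbrs v)"
    using card_mono[of "insert v (nbrs v)" V] small card_V finite_nbrs by force
  then obtain r where r: "r \<in> V" "r \<noteq> v" "r \<notin> nbrs v" by blast
  have "k \<le> card (nbrs v)"
    by (rule card_boundary_ge[of "{v}" _ r]) (use assms r nbrs_subset[of v] edge_in_V[of v v] in \<open>auto simp: nbrs_def\<close>)
  then show False using \<open>\<not> k \<le> degree E v\<close> degree_eq_card_nbrs by simp
qed

text \<open>A separation of \<open>G - xy\<close> whose sides are joined in \<open>G\<close> by
  \<open>xy\<close> alone. The triple is ordered: the last set is the far side, whose size drives
  the later induction and the minimal choice.\<close>

definition edge_sep :: "'a \<Rightarrow> 'a \<Rightarrow> 'a set \<Rightarrow> 'a set \<Rightarrow> 'a set \<Rightarrow> bool" where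
  "edge_sep x y A S B \<longleftrightarrow> {x, y} \<in> E \<and> x \<in> A \<and> y \<in> B \<and> A \<union> S \<union> B = V \<and>
     A \<inter> S = {} \<and> A \<inter> B = {} \<and> S \<inter> B = {} \<and> card S = k - 1 \<and>
     (\<forall>a\<in>A. \<forall>b\<in>B. {a, b} \<in> E \<longrightarrow> a = x \<and> b = y)"

lemma edge_sep_parts:
  assumes "edge_sep x y A S B"
  shows "A \<union> S \<union> B = V" "A \<inter> S = {}" "A \<inter> B = {}" "S \<inter> B = {}" "card S = k - 1"
    "x \<in> A" "y \<in> B" "{x, y} \<in> E"
  using assms by (simp_all add: edge_sep_def)

lemma edge_sep_swap: "edge_sep x y A S B \<Longrightarrow> edge_sep y x B S A"
  unfolding edge_sep_def by (auto simp: insert_commute)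

lemma edge_sep_crossing:
  "edge_sep x y A S B \<Longrightarrow> {u, v} \<in> E \<Longrightarrow> u \<in> A \<Longrightarrow> v \<in> B \<Longrightarrow> u = x \<and> v = y"
  unfolding edge_sep_def by blast

text \<open>Minimality yields a separator \<open>S\<close> of \<open>G - xy\<close>;
  \<open>A\<close> is what one vertex still reaches. Only \<open>xy\<close> can join
  \<open>A\<close> to \<open>B\<close>, and it does, since \<open>S\<close> is too small to separate
  \<open>G\<close> itself.\<close>

lemma ex_edge_sep:
  assumes e: "{x, y} \<in> E"
  shows "\<exists>A S B. edge_sep x y A S B"
proof -
  have "\<not> k_connected k V (E - {{x, y}})"
    using e minimal by (auto simp: minimally_k_connected_def)
  then obtain S where S: "S \<subseteq> V" "\<not> connected_in (V - S) (E - {{x, y}})" "card S = k - 1"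
    using card_V by (auto simp: k_connected_def separator_def)
  define R where "R = (adj_in (V - S) (E - {{x, y}}))\<^sup>*"
  obtain u v where uv: "u \<in> V - S" "v \<in> V - S" "(u, v) \<notin> R"
    using S by (auto simp: connected_in_def R_def)
  define A where "A = {w. (u, w) \<in> R}"
  define B where "B = V - S - A"
  have A: "A \<subseteq> V - S" "u \<in> A"
    using uv adj_in_rtrancl_closed by (fastforce simp: A_def R_def)+
  have no: "{a, b} = {x, y}" if "a \<in> A" "b \<in> B" "{a, b} \<in> E" for a b
  proof (rule ccontr)
    assume "{a, b} \<noteq> {x, y}"
    then have "(a, b) \<in> adj_in (V - S) (E - {{x, y}})"
      using that A by (auto simp: adj_in_def B_def)
    then have "b \<in> A" using that unfolding A_def R_def by (simp add: rtrancl_into_rtrancl)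
    then show False using that by (simp add: B_def)
  qed
  have "\<exists>a\<in>A. \<exists>b\<in>B. {a, b} \<in> E"
  proof (rule ccontr)
    assume none: "\<not> (\<exists>a\<in>A. \<exists>b\<in>B. {a, b} \<in> E)"
    have "k \<le> card S"
      by (rule card_boundary_ge[of A _ v]) (use none A S uv in \<open>auto simp: A_def B_def\<close>)
    then show False using S k2 by simp
  qed
  then obtain a b where ab: "a \<in> A" "b \<in> B" "{a, b} \<in> E" by blast
  then have "edge_sep a b A S B"
    unfolding edge_sep_def
  proof (intro conjI ballI impI)
    show "c = a" "d = b" if "c \<in> A" "d \<in> B" "{c, d} \<in> E" for c d
      using no[OF that] no[OF ab] ab that by (auto simp: B_def doubleton_eq_iff)
  qed (use A S in \<open>auto simp: B_def\<close>)
  \<comment> \<open>Which end lies in \<open>A\<close> is unknown, hence the later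
    \<open>edge_sep_swap\<close>.\<close>
  moreover have "a = x \<and> b = y \<or> a = y \<and> b = x" using no[OF ab] by (auto simp: doubleton_eq_iff)
  ultimately show ?thesis using edge_sep_swap by blast
qed

section \<open>Uncrossing two separations\<close>

text \<open>Row and column sums of the three by three table of intersections. The sums for
  \<open>S\<close> and \<open>T\<close> make the borders of opposite corners add up to
  \<open>2 * (k - 1)\<close>, the source of all later contradictions.\<close>

lemma edge_sep_cards:
  assumes e: "edge_sep x y A S B" and f: "edge_sep a b P T Q"
  shows "card (A \<inter> P) + card (A \<inter> T) + card (A \<inter> Q) = card A"
    "card (S \<inter> P) + card (S \<inter> T) + card (S \<inter> Q) = k - 1"
    "card (B \<inter> P) + card (B \<inter> T) + card (B \<inter> Q) = card B"
    "card (A \<inter> T) + card (S \<inter> T) + card (B \<inter> T) = k - 1"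
    "card (A \<inter> P) + card (S \<inter> P) + card (B \<inter> P) = card P"
    "card (A \<inter> Q) + card (S \<inter> Q) + card (B \<inter> Q) = card Q"
proof -
  have split: "card (X \<inter> C) + card (X \<inter> D) + card (X \<inter> W) = card X"
    if "X \<subseteq> V" "C \<union> D \<union> W = V" "C \<inter> D = {}" "C \<inter> W = {}" "D \<inter> W = {}" for X C D W
  proof -
    have fin: "finite (X \<inter> Y)" for Y using that finite_V finite_subset by blast
    have "card X = card (X \<inter> C \<union> X \<inter> D \<union> X \<inter> W)" using that by (intro arg_cong[of _ _ card]) blast
    also have "\<dots> = card (X \<inter> C \<union> X \<inter> D) + card (X \<inter> W)"
      using that fin by (intro card_Un_disjoint) auto
    also have "card (X \<inter> C \<union> X \<inter> D) = card (X \<inter> C) + card (X \<inter> D)"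
      using that fin by (intro card_Un_disjoint) auto
    finally show ?thesis by simp
  qed
  have e': "A \<union> S \<union> B = V" "A \<inter> S = {}" "A \<inter> B = {}" "S \<inter> B = {}" "card S = k - 1"
    using edge_sep_parts[OF e] by simp_all
  have f': "P \<union> T \<union> Q = V" "P \<inter> T = {}" "P \<inter> Q = {}" "T \<inter> Q = {}" "card T = k - 1"
    using edge_sep_parts[OF f] by simp_all
  have sub: "A \<subseteq> V" "S \<subseteq> V" "B \<subseteq> V" "P \<subseteq> V" "T \<subseteq> V" "Q \<subseteq> V" using e' f' by blast+
  show "card (A \<inter> P) + card (A \<inter> T) + card (A \<inter> Q) = card A"
    "card (S \<inter> P) + card (S \<inter> T) + card (S \<inter> Q) = k - 1"
    "card (B \<inter> P) + card (B \<inter> T) + card (B \<inter> Q) = card B"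
    using split[OF sub(1) f'(1-4)] split[OF sub(2) f'(1-4)] split[OF sub(3) f'(1-4)] e'(5)
    by simp_all
  show "card (A \<inter> T) + card (S \<inter> T) + card (B \<inter> T) = k - 1"
    "card (A \<inter> P) + card (S \<inter> P) + card (B \<inter> P) = card P"
    "card (A \<inter> Q) + card (S \<inter> Q) + card (B \<inter> Q) = card Q"
    using split[OF sub(5) e'(1-4)] split[OF sub(4) e'(1-4)] split[OF sub(6) e'(1-4)] f'(5)
    by (simp_all add: Int_commute[of A] Int_commute[of S] Int_commute[of B])
qed

text \<open>For separations \<open>(A, S, B)\<close> and \<open>(P, T, Q)\<close>: the vertices separating the corner \<open>B \<inter> P\<close> from the
  rest, up to the two crossing edges.\<close>

definition border :: "'a set \<Rightarrow> 'a set \<Rightarrow> 'a set \<Rightarrow> 'a set \<Rightarrow> 'a set" where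
  "border B S P T = (B \<inter> T) \<union> (S \<inter> T) \<union> (S \<inter> P)"

lemma border_commute: "border B S P T = border P T B S"
  by (auto simp: border_def)

lemma card_border_le:
  "card (border B S P T \<union> Z) \<le> card (B \<inter> T) + card (S \<inter> T) + card (S \<inter> P) + card Z"
  unfolding border_def
  by (meson add_mono_thms_linordered_semiring(3) card_Un_le le_trans)

text \<open>An edge that leaves the corner and misses its border must cross one of the two
  separations, so it is \<open>xy\<close> or \<open>ab\<close>.\<close>

lemma corner_edge_cases:
  assumes e: "edge_sep x y A S B" and f: "edge_sep a b P T Q"
    and "u \<in> B \<inter> P" "{u, w} \<in> E" "w \<notin> B \<inter> P" "w \<notin> border B S P T"
  shows "u = y \<and> w = x \<or> u = a \<and> w = b"
proof -
  have "w \<in> V" using assms(4) edge_in_V by blast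
  then have "w \<in> A \<or> w \<in> Q" using assms(3,5,6) edge_sep_parts(1)[OF e] edge_sep_parts(1)[OF f]
    unfolding border_def by blast
  then show ?thesis
    using edge_sep_crossing[OF e, of w u] edge_sep_crossing[OF f, of u w] assms(3,4)
    by (auto simp: insert_commute)
qed

text \<open>The set \<open>Z\<close> blocks those of the edges \<open>xy\<close> and
  \<open>ab\<close> that leave the corner; then \<open>border B S P T \<union> Z\<close> separates
  the corner from \<open>r\<close>.\<close>

lemma corner_boundary_ge:
  assumes e: "edge_sep x y A S B" and f: "edge_sep a b P T Q"
    and ne: "B \<inter> P \<noteq> {}" and Z: "Z \<subseteq> V" "Z \<inter> (B \<inter> P) = {}"
    and "y \<in> P \<Longrightarrow> x \<in> Z" "a \<in> B \<Longrightarrow> b \<in> Z" and r: "r \<in> A \<union> Q" "r \<notin> Z"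
  shows "k \<le> card (border B S P T \<union> Z)"
proof (rule card_boundary_ge[of "B \<inter> P" _ r])
  show "{u, w} \<notin> E" if "u \<in> B \<inter> P" "w \<notin> B \<inter> P" "w \<notin> border B S P T \<union> Z" for u w
    using corner_edge_cases[OF e f that(1) _ that(2)] that assms(6,7) by blast
  show "B \<inter> P \<subseteq> V" "border B S P T \<union> Z \<subseteq> V" "B \<inter> P \<inter> (border B S P T \<union> Z) = {}"
    "r \<in> V" "r \<notin> B \<inter> P" "r \<notin> border B S P T \<union> Z"
    using edge_sep_parts(1-4)[OF e] edge_sep_parts(1-4)[OF f] Z r unfolding border_def by blast+
qed (use ne in auto)

text \<open>Blocking \<open>xy\<close> by \<open>x\<close> costs one vertex, so the set without
  \<open>x\<close> has at least \<open>k - 1\<close> vertices. With exactly \<open>k - 1\<close>,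
  the corner is the far side of a new separation of \<open>xy\<close>.\<close>

lemma corner_sep:
  assumes e: "edge_sep x y A S B" and f: "edge_sep a b P T Q"
    and y: "y \<in> P" and Z: "Z \<subseteq> V" "Z \<inter> (B \<inter> P) = {}" "x \<notin> Z"
    and ab: "a \<in> B \<Longrightarrow> b \<in> Z" and r: "r \<in> A \<union> Q" "r \<notin> Z" "r \<noteq> x"
  shows "k \<le> card (border B S P T \<union> Z) \<or>
    edge_sep x y (V - B \<inter> P - (border B S P T \<union> Z)) (border B S P T \<union> Z) (B \<inter> P)"
proof -
  let ?N = "border B S P T \<union> Z"
  have x: "x \<in> A" and yB: "y \<in> B" and xy: "{x, y} \<in> E" using edge_sep_parts[OF e] by simp_all
  have NV: "?N \<subseteq> V"
    using edge_sep_parts(1)[OF e] edge_sep_parts(1)[OF f] Z unfolding border_def by blast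
  have "k \<le> card (border B S P T \<union> insert x Z)"
    by (rule corner_boundary_ge[OF e f, of _ r]) (use assms x yB edge_sep_parts[OF e] in auto)
  also have "\<dots> \<le> Suc (card ?N)" using finite_subset[OF NV finite_V] by (simp add: card_insert_if del: finite_Un)
  finally have "k \<le> card ?N \<or> card ?N = k - 1" using k2 by linarith
  moreover have "edge_sep x y (V - B \<inter> P - ?N) ?N (B \<inter> P)" if "card ?N = k - 1"
    unfolding edge_sep_def
  proof (intro conjI ballI impI)
    show "w = x" "u = y" if "w \<in> V - B \<inter> P - ?N" "u \<in> B \<inter> P" "{w, u} \<in> E" for w u
      using corner_edge_cases[OF e f that(2), of w] that ab y by (auto simp: insert_commute)
    show "x \<in> V - B \<inter> P - ?N" using x Z edge_sep_parts(1-4)[OF e] unfolding border_def by blast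
    show "(V - B \<inter> P - ?N) \<union> ?N \<union> B \<inter> P = V" using NV edge_sep_parts(1)[OF e] by blast
    show "?N \<inter> (B \<inter> P) = {}" using Z edge_sep_parts(1-4)[OF e] edge_sep_parts(1-4)[OF f] unfolding border_def by blast
  qed (use xy y yB that in auto)
  ultimately show ?thesis by blast
qed

text \<open>Consecutive edges \<open>wx\<close>, \<open>xz\<close> of a path through a vertex of large degree have
  separations whose far sides shrink strictly; this forbids cycles through such vertices only.\<close>

lemma consecutive_seps:
  assumes e: "edge_sep w x A S B" and f: "edge_sep x z P T Q"
    and deg: "degree E x > k" and wz: "w \<noteq> z"
  shows "A \<inter> Q = {}" "card Q < card B"
proof -
  have mem: "w \<in> A" "x \<in> B" "x \<in> P" "z \<in> Q" "{x, w} \<in> E" "{x, z} \<in> E"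
    using e f by (auto simp: edge_sep_def insert_commute)
  have wQ: "w \<notin> Q" using edge_sep_crossing[OF f] mem wz by blast
  have zA: "z \<notin> A"
    using edge_sep_crossing[OF edge_sep_swap[OF e], of x z] mem wz by blast
  let ?M = "card (B \<inter> T) + card (S \<inter> T) + card (S \<inter> P)"
  let ?N = "border B S P T"
  have fin: "finite ?N" 
    by (rule finite_subset[OF _ finite_V])
      (use edge_sep_parts(1)[OF e] edge_sep_parts(1)[OF f] in \<open>auto simp: border_def\<close>)
  have cN: "card ?N \<le> ?M" using card_border_le[of B S P T "{}"] by simp
  \<comment> \<open>The large degree of \<open>x\<close> enters here: if the corner is just
    \<open>x\<close>, all its neighbours except \<open>w\<close> and \<open>z\<close> lie in the
    border.\<close>
  have M: "k - 1 \<le> ?M"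
  proof (cases "B \<inter> P = {x}")
    case True
    have "nbrs x \<subseteq> ?N \<union> {w, z}"
    proof
      fix u assume u: "u \<in> nbrs x"
      then have "u \<noteq> x" using nbrs_subset by blast
      then show "u \<in> ?N \<union> {w, z}"
        using corner_edge_cases[OF e f, of x u] u True mem by (auto simp: nbrs_def)
    qed
    then have "card (nbrs x) \<le> card (?N \<union> {w, z})" using fin by (intro card_mono) auto
    also have "\<dots> \<le> card ?N + card {w, z}" by (rule card_Un_le)
    also have "\<dots> \<le> ?M + 2" using cN wz by simp
    finally show ?thesis using deg degree_eq_card_nbrs by simp
  next
    case False
    \<comment> \<open>Both crossing edges leave the corner at \<open>x\<close>, so moving
      \<open>x\<close> into the boundary blocks both at once.\<close>
    have "k \<le> card (insert x ?N)"
    proof (rule card_boundary_ge[of "B \<inter> P - {x}" _ w])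
      show "{u, v} \<notin> E" if "u \<in> B \<inter> P - {x}" "v \<notin> B \<inter> P - {x}" "v \<notin> insert x ?N" for u v
        using corner_edge_cases[OF e f, of u v] that by blast
      show "w \<notin> insert x ?N" "w \<in> V" "insert x ?N \<subseteq> V" "B \<inter> P - {x} \<subseteq> V"
        "(B \<inter> P - {x}) \<inter> insert x ?N = {}" "w \<notin> B \<inter> P - {x}" "B \<inter> P - {x} \<noteq> {}"
        using edge_sep_parts(1-4)[OF e] edge_sep_parts(1-4)[OF f] mem False unfolding border_def by blast+
    qed
    then show ?thesis using cN fin by (simp add: card_insert_if split: if_splits)
  qed
  note cards = edge_sep_cards[OF e f]
  \<comment> \<open>No crossing edge leaves the opposite corner, so its border would have
    \<open>k\<close> vertices; together with \<open>M\<close> this exceeds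
    \<open>2 * (k - 1)\<close>.\<close>
  show 1: "A \<inter> Q = {}"
  proof (rule ccontr)
    assume ne: "A \<inter> Q \<noteq> {}"
    have "k \<le> card (border A S Q T \<union> {})"
      by (rule corner_boundary_ge[OF edge_sep_swap[OF e] edge_sep_swap[OF f] ne, of _ x])
        (use wQ zA mem in auto)
    also have "\<dots> \<le> card (A \<inter> T) + card (S \<inter> T) + card (S \<inter> Q)"
      using card_border_le[of A S Q T "{}"] by simp
    finally show False using M cards(2,4) k2 by linarith
  qed
  \<comment> \<open>From \<open>M\<close> and the sum for \<open>S\<close>,
    \<open>card (S \<inter> Q) \<le> card (B \<inter> T)\<close>; the vertex \<open>x\<close> in
    \<open>B \<inter> P\<close> makes the comparison strict.\<close>
  have "card (B \<inter> P) \<ge> 1"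
    using mem edge_sep_parts(1)[OF e] finite_V by (simp add: Suc_le_eq card_gt_0_iff) blast
  then show "card Q < card B" using 1 M cards by simp
qed

section \<open>The forest of vertices of large degree\<close>

definition core :: "'a set" where
  "core = V - Vdeg k V E"

lemma core_iff: "v \<in> core \<longleftrightarrow> v \<in> V \<and> degree E v > k"
  using degree_ge[of v] by (auto simp: core_def Vdeg_def)

lemma finite_core: "finite core"
  using finite_V by (simp add: core_def)

lemma Vdeg_iff: "v \<in> Vdeg k V E \<longleftrightarrow> v \<in> V \<and> v \<notin> core"
  by (auto simp: core_def Vdeg_def)

text \<open>A cycle of \<open>F\<close> through \<open>xy\<close> would continue with some edge
  \<open>yz\<close>, which has a smaller far side and lies on a cycle too. Induction on the far side
  excludes this.\<close>

lemma far_end_unreachable: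
  assumes "edge_sep x y A S B" "x \<in> core" "y \<in> core"
  shows "(y, x) \<notin> (adj_in core (E - {{x, y}}))\<^sup>*"
  using assms
proof (induction "card B" arbitrary: x y A S B rule: less_induct)
  case less
  let ?R = "adj_in core (E - {{x, y}})"
  have xy: "x \<noteq> y" "{x, y} \<in> E"
    using edge_sep_parts[OF less.prems(1)] edge_in_V by blast+
  show ?case
  proof
    assume "(y, x) \<in> ?R\<^sup>*"
    then obtain z where z: "(y, z) \<in> ?R" "z \<noteq> y"
      and zx: "(z, x) \<in> (?R \<inter> (- {y}) \<times> (- {y}))\<^sup>*"
      using rtrancl_last_departure[OF _ xy(1)] by blast
    have z': "{y, z} \<in> E" "z \<in> core" "z \<noteq> x" using z by (auto simp: adj_in_def)
    obtain P T Q where f: "edge_sep y z P T Q" using ex_edge_sep z' by blast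
    have "card Q < card B"
      using consecutive_seps(2)[OF less.prems(1) f] less.prems z' by (auto simp: core_iff)
    then have no: "(z, y) \<notin> (adj_in core (E - {{y, z}}))\<^sup>*"
      using less.hyps[OF _ f less.prems(3) z'(2)] by blast
    \<comment> \<open>The rest of the cycle, closed by \<open>xy\<close>, leads from
      \<open>z\<close> back to \<open>y\<close> without using \<open>yz\<close>.\<close>
    from zx have "(z, x) \<in> (adj_in core (E - {{y, z}}))\<^sup>*"
      by (rule adj_in_rtrancl_avoiding) blast
    moreover have "(x, y) \<in> adj_in core (E - {{y, z}})"
      using xy less.prems z' by (auto simp: adj_in_def doubleton_eq_iff)
    ultimately show False using no by (meson rtrancl.rtrancl_into_rtrancl)
  qed
qed

lemma card_core_edges: "card {e \<in> E. e \<subseteq> core} + cF k V E = card core"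
proof -
  let ?E = "{e \<in> E. e \<subseteq> core}"
  have "card ?E + card (components_in core ?E) = card core"
  proof (rule forest_card)
    show "\<exists>u v. e = {u, v} \<and> u \<in> core \<and> v \<in> core" if "e \<in> ?E" for e
    proof -
      from that have "e \<in> E" by simp
      then obtain u v where "e = {u, v}" by (rule edgeE)
      then show ?thesis using that by auto
    qed
    show "(u, v) \<notin> (adj_in core (?E - {{u, v}}))\<^sup>*" if uv: "{u, v} \<in> ?E" for u v
    proof -
      obtain A S B where "edge_sep v u A S B"
        using ex_edge_sep[of v u] uv by (auto simp: insert_commute)
      then have "(u, v) \<notin> (adj_in core (E - {{u, v}}))\<^sup>*"
        using far_end_unreachable[of v u] uv by (simp add: insert_commute)
      then show ?thesis using adj_in_rtrancl_mono[of u v core "?E - {{u, v}}"] by blast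
    qed
  qed (use finite_E finite_core in auto)
  moreover have "adj_in core ?E = adj_in core E" by (auto simp: adj_in_def)
  ultimately show ?thesis by (simp add: cF_def core_def components_in_def)
qed

lemma sum_card_Int_eq_sum_degree:
  assumes "finite W"
  shows "(\<Sum>e\<in>E. card (e \<inter> W)) = (\<Sum>v\<in>W. degree E v)"
proof -
  have "(\<Sum>e\<in>E. card (e \<inter> W)) = (\<Sum>e\<in>E. \<Sum>v\<in>W. if v \<in> e then 1 else 0)"
    using assms by (intro sum.cong) (simp_all add: sum.If_cases Int_commute Int_def)
  also have "\<dots> = (\<Sum>v\<in>W. \<Sum>e\<in>E. if v \<in> e then 1 else 0)" by (rule sum.swap)
  also have "\<dots> = (\<Sum>v\<in>W. degree E v)"
    using finite_E by (intro sum.cong) (simp_all add: sum.If_cases degree_def Int_def)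
  finally show ?thesis .
qed

text \<open>Double counting of the edge ends in \<open>V\<^sub>k\<close>, arranged as sums so that
  no subtraction of naturals occurs.\<close>

lemma card_edges:
  "card E + card (Edeg k V E) = card {e \<in> E. e \<subseteq> core} + k * card (Vdeg k V E)"
proof -
  let ?W = "Vdeg k V E"
  \<comment> \<open>An edge has one end in \<open>V\<^sub>k\<close>, except for none if it lies in
    \<open>F\<close> and two if it lies in \<open>E\<^sub>k\<close>.\<close>
  have "card (e \<inter> ?W) + (if e \<subseteq> core then 1 else 0) = 1 + (if e \<subseteq> ?W then 1 else 0)"
    if e: "e \<in> E" for e
  proof -
    obtain u v where "e = {u, v}" "u \<noteq> v" "u \<in> V" "v \<in> V" using e by (rule edgeE)
    then show ?thesis by (auto simp: Vdeg_iff Int_insert_left)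
  qed
  then have "(\<Sum>e\<in>E. card (e \<inter> ?W) + (if e \<subseteq> core then 1 else 0))
      = (\<Sum>e\<in>E. 1 + (if e \<subseteq> ?W then 1 else 0))"
    by (intro sum.cong) simp_all
  then have "(\<Sum>e\<in>E. card (e \<inter> ?W)) + card {e \<in> E. e \<subseteq> core} = card E + card (Edeg k V E)"
    using finite_E unfolding sum.distrib by (simp add: sum.If_cases Edeg_def Int_def)
  moreover have "(\<Sum>v\<in>?W. degree E v) = k * card ?W" by (simp add: Vdeg_def)
  moreover have "finite ?W" using finite_V by (simp add: Vdeg_def)
  ultimately show ?thesis using sum_card_Int_eq_sum_degree[of ?W] by simp
qed

lemma edge_count: "card E + card (Edeg k V E) + cF k V E + card (Vdeg k V E)
    = card V + k * card (Vdeg k V E)"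
proof -
  have "card core = card V - card (Vdeg k V E)" "card (Vdeg k V E) \<le> card V"
    unfolding core_def using finite_V by (auto simp: Vdeg_def card_Diff_subset intro!: card_mono)
  then show ?thesis using card_edges card_core_edges by linarith
qed

section \<open>A vertex of degree k whose edges into the forest close no cycle\<close>

text \<open>If every forest edge has a separation avoiding \<open>v\<close>, then along a forest path the side
  containing \<open>v\<close> cannot switch, so a path starting and ending in neighbours of \<open>v\<close> is trivial.\<close>

lemma far_side_nonadjacent:
  assumes v: "v \<notin> core"
    and avoid: "\<And>p q. {p, q} \<in> E \<Longrightarrow> p \<in> core \<Longrightarrow> q \<in> core \<Longrightarrow> \<exists>P T Q. edge_sep p q P T Q \<and> v \<notin> T"
    and "edge_sep p q P T Q" "p \<in> core" "q \<in> core" "v \<in> P"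
    and "(q, w) \<in> (adj_in core (E - {{p, q}}))\<^sup>*"
  shows "{v, w} \<notin> E"
  using assms(3-)
proof (induction "card Q" arbitrary: p q P T Q rule: less_induct)
  case less
  let ?R = "adj_in core (E - {{p, q}})"
  show ?case
  proof (cases "w = q")
    case True
    \<comment> \<open>An edge \<open>vq\<close> would cross the separation and force
      \<open>v = p\<close>, but \<open>p\<close> lies in \<open>core\<close>.\<close>
    then show ?thesis
      using edge_sep_crossing[OF less.prems(1) _ less.prems(4)] edge_sep_parts(7)[OF less.prems(1)]
        less.prems(2) v by metis
  next
    case False
    then obtain z where z: "(q, z) \<in> ?R" "z \<noteq> q"
      and zw: "(z, w) \<in> (?R \<inter> (- {q}) \<times> (- {q}))\<^sup>*"
      using rtrancl_last_departure[OF less.prems(5)] by blast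
    have z': "{q, z} \<in> E" "z \<in> core" "p \<noteq> z"
      using z by (auto simp: adj_in_def insert_commute)
    obtain P' T' Q' where f: "edge_sep q z P' T' Q'" "v \<notin> T'" using avoid[OF z'(1) less.prems(3) z'(2)] by blast
    note c = consecutive_seps[OF less.prems(1) f(1) _ z'(3)]
    have "P \<inter> Q' = {}" "card Q' < card Q" using c less.prems by (auto simp: core_iff)
    \<comment> \<open>\<open>P \<inter> Q' = {}\<close> excludes \<open>Q'\<close> and the choice of
      \<open>f\<close> excludes \<open>T'\<close>.\<close>
    moreover from this have "v \<in> P'"
      using f edge_sep_parts(1)[OF f(1)] edge_sep_parts(1)[OF less.prems(1)] less.prems(4) by blast
    moreover from zw have "(z, w) \<in> (adj_in core (E - {{q, z}}))\<^sup>*"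
      by (rule adj_in_rtrancl_avoiding) blast
    ultimately show ?thesis using less.hyps[OF _ f(1) less.prems(3) z'(2)] by blast
  qed
qed

text \<open>Take the first edge \<open>az\<close> of a forest path from \<open>a\<close> to
  \<open>b\<close> and its separation avoiding \<open>v\<close>. If \<open>v\<close> is on the side
  of \<open>a\<close>, it cannot be adjacent to \<open>b\<close>; otherwise the edge
  \<open>av\<close> crosses and \<open>v = z\<close>, although \<open>v\<close> is not in
  \<open>core\<close>.\<close>

lemma core_nbrs_in_distinct_components:
  assumes v: "v \<in> Vdeg k V E"
    and avoid: "\<And>p q. {p, q} \<in> E \<Longrightarrow> p \<in> core \<Longrightarrow> q \<in> core \<Longrightarrow> \<exists>P T Q. edge_sep p q P T Q \<and> v \<notin> T"
    and a: "a \<in> nbrs v \<inter> core" and b: "b \<in> nbrs v \<inter> core"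
    and ab: "(a, b) \<in> (adj_in core E)\<^sup>*"
  shows "a = b"
proof (rule ccontr)
  assume "a \<noteq> b"
  then obtain z where z: "(a, z) \<in> adj_in core E" "z \<noteq> a"
    and zb: "(z, b) \<in> (adj_in core E \<inter> (- {a}) \<times> (- {a}))\<^sup>*"
    using rtrancl_last_departure[OF ab] by blast
  have z': "{a, z} \<in> E" "z \<in> core" using z by (auto simp: adj_in_def)
  then obtain P T Q where f: "edge_sep a z P T Q" "v \<notin> T" using avoid[OF z'(1) _ z'(2)] a by blast
  have v': "v \<in> V" "v \<notin> core" using v by (auto simp: Vdeg_iff)
  from zb have zb': "(z, b) \<in> (adj_in core (E - {{a, z}}))\<^sup>*"
    by (rule adj_in_rtrancl_avoiding) blast
  show False
  proof (cases "v \<in> P")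
    case True
    then show False
      using far_side_nonadjacent[OF v'(2) avoid f(1) _ z'(2) True zb'] a b by (auto simp: nbrs_def)
  next
    case False
    then have "v \<in> Q" using f v' edge_sep_parts(1)[OF f(1)] by blast
    then show False
      using edge_sep_crossing[OF f(1), of a v] edge_sep_parts[OF f(1)] a v' z'
      by (auto simp: nbrs_def insert_commute)
  qed
qed

lemma card_nbrs_Vdeg_le_Edeg:
  assumes "v \<in> Vdeg k V E"
  shows "card (nbrs v \<inter> Vdeg k V E) \<le> card (Edeg k V E)"
proof (rule card_inj_on_le[of "\<lambda>w. {v, w}"])
  show "finite (Edeg k V E)" using finite_E by (simp add: Edeg_def)
qed (use assms in \<open>auto simp: inj_on_def doubleton_eq_iff Edeg_def nbrs_def\<close>)

lemma card_nbrs_split: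
  "card (nbrs v \<inter> core) + card (nbrs v \<inter> Vdeg k V E) = degree E v"
proof -
  have "nbrs v = nbrs v \<inter> core \<union> nbrs v \<inter> Vdeg k V E"
    using nbrs_subset[of v] by (auto simp: Vdeg_iff)
  then have "card (nbrs v) = card (nbrs v \<inter> core \<union> nbrs v \<inter> Vdeg k V E)" by simp
  also have "\<dots> = card (nbrs v \<inter> core) + card (nbrs v \<inter> Vdeg k V E)"
    using finite_nbrs by (intro card_Un_disjoint) (auto simp: Vdeg_iff)
  finally show ?thesis by (simp add: degree_eq_card_nbrs)
qed

text \<open>Of the \<open>k\<close> neighbours of \<open>v\<close>, at most one lies in each
  component of \<open>F\<close>; each remaining one gives its own edge of
  \<open>E\<^sub>k\<close>.\<close>

lemma bound_if_avoiding:
  assumes v: "v \<in> Vdeg k V E"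
    and avoid: "\<And>p q. {p, q} \<in> E \<Longrightarrow> p \<in> core \<Longrightarrow> q \<in> core \<Longrightarrow> \<exists>P T Q. edge_sep p q P T Q \<and> v \<notin> T"
  shows "k \<le> cF k V E + card (Edeg k V E)"
proof -
  have "card (nbrs v \<inter> core) \<le> card (components_in core E)"
    by (rule card_le_components)
      (use finite_core core_nbrs_in_distinct_components[OF v avoid] in blast)+
  then have "card (nbrs v \<inter> core) \<le> cF k V E" by (simp add: cF_def core_def)
  moreover have "degree E v = k" using v by (simp add: Vdeg_def)
  ultimately show ?thesis
    using card_nbrs_split[of v] card_nbrs_Vdeg_le_Edeg[OF v] by linarith
qed

section \<open>Separations with a smallest side\<close>

text \<open>Only far sides are compared, but by \<open>edge_sep_swap\<close> each side of a
  separation is a far side.\<close>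

definition min_sep :: "'a \<Rightarrow> 'a \<Rightarrow> 'a set \<Rightarrow> 'a set \<Rightarrow> 'a set \<Rightarrow> bool" where
  "min_sep x y A S B \<longleftrightarrow> edge_sep x y A S B \<and> x \<in> core \<and> y \<in> core \<and>
     (\<forall>p q C D W. edge_sep p q C D W \<longrightarrow> p \<in> core \<longrightarrow> q \<in> core \<longrightarrow> card B \<le> card W)"

lemma min_sepD:
  assumes "min_sep x y A S B"
  shows "edge_sep x y A S B" "x \<in> core" "y \<in> core"
  using assms by (simp_all add: min_sep_def)

lemma min_sep_le:
  "min_sep x y A S B \<Longrightarrow> edge_sep p q C D W \<Longrightarrow> p \<in> core \<Longrightarrow> q \<in> core \<Longrightarrow> card B \<le> card W"
  unfolding min_sep_def by blast

lemma ex_min_sep: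
  assumes "{p, q} \<in> E" "p \<in> core" "q \<in> core"
  shows "\<exists>x y A S B. min_sep x y A S B"
proof -
  define G where "G n \<longleftrightarrow> (\<exists>x y A S B. edge_sep x y A S B \<and> x \<in> core \<and> y \<in> core \<and> card B = n)" for n
  have "\<exists>n. G n" using ex_edge_sep assms unfolding G_def by blast
  then have "G (Least G)" by (rule LeastI_ex)
  then obtain x y A S B where s: "edge_sep x y A S B" "x \<in> core" "y \<in> core" "card B = Least G"
    unfolding G_def by blast
  have "card B \<le> card W" if "edge_sep p q C D W" "p \<in> core" "q \<in> core" for p q C D W
    unfolding s(4) by (rule Least_le) (use that G_def in blast)
  then show ?thesis using s unfolding min_sep_def by blast
qed

lemma edge_sep_finite:
  assumes "edge_sep x y A S B"
  shows "finite A" "finite S" "finite B"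
  using edge_sep_parts(1)[OF assms] finite_V by (metis finite_Un)+

text \<open>More than \<open>k\<close> neighbours of \<open>y\<close> cannot all fit into
  \<open>S\<close> and \<open>{x}\<close>. The second vertex of a side later serves as the
  \<open>r\<close> of the corner lemmas.\<close>

lemma card_far_side_ge:
  assumes s: "edge_sep x y A S B" and y: "y \<in> core"
  shows "2 \<le> card B"
proof -
  note p = edge_sep_parts[OF s] and fin = edge_sep_finite[OF s]
  have "nbrs y \<subseteq> (B - {y}) \<union> S \<union> {x}"
  proof
    fix w assume w: "w \<in> nbrs y"
    then have "w \<in> V" "w \<noteq> y" "{w, y} \<in> E"
      using nbrs_subset[of y] by (auto simp: nbrs_def insert_commute)
    then show "w \<in> (B - {y}) \<union> S \<union> {x}" using edge_sep_crossing[OF s, of w y] p by blast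
  qed
  then have "card (nbrs y) \<le> card ((B - {y}) \<union> S \<union> {x})" using fin by (intro card_mono) auto
  also have "\<dots> \<le> card ((B - {y}) \<union> S) + card {x}" by (rule card_Un_le)
  also have "card ((B - {y}) \<union> S) \<le> card (B - {y}) + card S" by (rule card_Un_le)
  finally have "k < card (B - {y}) + (k - 1) + 1"
    using y p by (simp add: core_iff degree_eq_card_nbrs)
  then show ?thesis using fin p k2 by simp
qed

lemma other_vertex:
  assumes "2 \<le> card B"
  shows "\<exists>r\<in>B. r \<noteq> y"
proof -
  have "\<not> B \<subseteq> {y}" using card_mono[of "{y}" B] assms by auto
  then show ?thesis by blast
qed

text \<open>As for consecutive edges, the counts give \<open>card Q < card B\<close>, now against
  minimality.\<close>

lemma min_sep_corner_contra:
  assumes m: "min_sep x y A S B" and f: "edge_sep a b P T Q" and ab: "a \<in> core" "b \<in> core"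
    and "B \<inter> P \<noteq> {}" "A \<inter> Q = {}"
    and "k - 1 \<le> card (B \<inter> T) + card (S \<inter> T) + card (S \<inter> P)"
  shows False
proof -
  have "card (B \<inter> P) > 0"
    using assms(5) edge_sep_finite[OF min_sepD(1)[OF m]] by (simp add: card_gt_0_iff)
  then show False
    using edge_sep_cards[OF min_sepD(1)[OF m] f] min_sep_le[OF m f ab] assms(6,7) by simp
qed

lemma core_edge_not_touching_min_side:
  assumes m: "min_sep x y A S B" and edge: "{a, b} \<in> E" and ab: "a \<in> core" "b \<in> core"
    and ne: "{a, b} \<noteq> {x, y}"
  shows "a \<notin> B"
proof
  assume aB: "a \<in> B"
  note e = min_sepD(1)[OF m]
  obtain P T Q where f: "edge_sep a b P T Q" using ex_edge_sep[OF edge] by blast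
  note pe = edge_sep_parts[OF e] and pf = edge_sep_parts[OF f]
  note fin = edge_sep_finite[OF e]
  have bA: "b \<notin> A"
  proof
    assume "b \<in> A"
    moreover have "{b, a} \<in> E" using edge by (simp add: insert_commute)
    ultimately have "b = x \<and> a = y" using edge_sep_crossing[OF e _ _ aB] by blast
    then show False using ne by (simp add: insert_commute)
  qed
  obtain r where r: "r \<in> A" "r \<noteq> x"
    using other_vertex[OF card_far_side_ge[OF edge_sep_swap[OF e] min_sepD(2)[OF m]]] by blast
  let ?M = "card (B \<inter> T) + card (S \<inter> T) + card (S \<inter> P)"
  \<comment> \<open>If \<open>B\<close> lay in \<open>P\<close>, then \<open>b\<close> would be in
    \<open>S\<close> with \<open>a\<close> as only neighbour in \<open>B\<close>. Exchanging
    \<open>b\<close> for \<open>a\<close> in \<open>S\<close> shrinks \<open>B\<close>, or for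
    \<open>a = y\<close> leaves a separator of \<open>k - 1\<close> vertices.\<close>
  have BP: "\<not> B \<subseteq> P"
  proof
    assume BP: "B \<subseteq> P"
    have bS: "b \<in> S" using bA BP pe pf by blast
    have only: "u = a" if "u \<in> B" "{u, b} \<in> E" for u
      using edge_sep_crossing[OF f that(2)] that BP pf by blast
    let ?S = "insert a (S - {b})"
    have cS: "card ?S = k - 1"
      using bS fin aB pe k2 by (subst card_insert_disjoint) (auto simp: card_gt_0_iff)
    show False
    proof (cases "a = y")
      case True
      have "k \<le> card ?S"
      proof (rule card_boundary_ge[of "B - {y}" _ x])
        show "B - {y} \<noteq> {}"
          using other_vertex[OF card_far_side_ge[OF e min_sepD(3)[OF m]]] by blast
        show "{u, w} \<notin> E" if u: "u \<in> B - {y}" and w: "w \<in> V" "w \<notin> B - {y}" "w \<notin> ?S" for u w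
        proof
          assume uw: "{u, w} \<in> E"
          then have "w \<noteq> b" using only u True by blast
          then have "w \<in> A" using w True pe by blast
          then show False
            using edge_sep_crossing[OF e, of w u] uw u by (auto simp: insert_commute)
        qed
      qed (use pe True bS in blast)+
      then show False using cS k2 by simp
    next
      case False
      have "edge_sep x y (insert b A) ?S (B - {a})"
        unfolding edge_sep_def
      proof (intro conjI ballI impI)
        show "w = x" "u = y" if "w \<in> insert b A" "u \<in> B - {a}" "{w, u} \<in> E" for w u
          using edge_sep_crossing[OF e, of w u] only[of u] that by (auto simp: insert_commute)
      qed (use pe False aB bS cS in blast)+
      then have "card B \<le> card (B - {a})" using min_sep_le[OF m] min_sepD[OF m] by blast
      then show False using card_Diff1_less[OF fin(3) aB] by linarith
    qed
  qed
  have "B \<inter> P \<subset> B" using BP by blast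
  then have proper: "\<not> card B \<le> card (B \<inter> P)"
    using psubset_card_mono[OF fin(3)] by (simp add: not_le)
  \<comment> \<open>The corner is smaller than \<open>B\<close>, so by minimality it is no far side,
    neither for \<open>xy\<close> nor for \<open>ba\<close>. If \<open>y\<close> is in
    \<open>P\<close>, the vertex \<open>b\<close> must be added to block \<open>ab\<close>, which
    costs one.\<close>
  have M: "k - 1 \<le> ?M \<and> (y \<notin> P \<longrightarrow> k \<le> ?M)"
  proof (cases "y \<in> P")
    case True
    have "k \<le> card (border B S P T \<union> {b}) \<or>
        edge_sep x y (V - B \<inter> P - (border B S P T \<union> {b})) (border B S P T \<union> {b}) (B \<inter> P)"
      by (rule corner_sep[OF e f True, of _ r]) (use bA r pe pf in blast)+
    then have "k \<le> card (border B S P T \<union> {b})"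
      using min_sep_le[OF m] min_sepD[OF m] proper by blast
    then show ?thesis using card_border_le[of B S P T "{b}"] True by simp
  next
    case False
    have "k \<le> card (border P T B S \<union> {}) \<or>
        edge_sep b a (V - P \<inter> B - (border P T B S \<union> {})) (border P T B S \<union> {}) (P \<inter> B)"
      by (rule corner_sep[OF edge_sep_swap[OF f] edge_sep_swap[OF e] aB, of _ x])
        (use bA False pe in blast)+
    then have "k \<le> card (border P T B S \<union> {})"
      using min_sep_le[OF m] ab proper by (metis Int_commute)
    then show ?thesis
      using card_border_le[of B S P T "{}"] by (simp add: border_commute[of P])
  qed
  note cards = edge_sep_cards[OF e f]
  have xQ: "y \<notin> P" if "x \<in> Q"
    using edge_sep_crossing[OF f, of y x] that pe ne by (auto simp: insert_commute)
  have "A \<inter> Q = {}"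
  proof (rule ccontr)
    assume AQ: "A \<inter> Q \<noteq> {}"
    \<comment> \<open>If \<open>x\<close> is in \<open>Q\<close>, blocking \<open>xy\<close> costs
      one vertex, but then \<open>y\<close> is not in \<open>P\<close> and \<open>M\<close> gains
      one.\<close>
    let ?Z = "if x \<in> Q then {y} else {}"
    have "k \<le> card (border A S Q T \<union> ?Z)"
      by (rule corner_boundary_ge[OF edge_sep_swap[OF e] edge_sep_swap[OF f] AQ, of _ a])
        (use bA xQ pe pf in \<open>auto split: if_splits\<close>)
    also have "\<dots> \<le> card (A \<inter> T) + card (S \<inter> T) + card (S \<inter> Q) + card ?Z"
      by (rule card_border_le)
    finally show False using M xQ cards(2,4) k2 by (auto split: if_splits)
  qed
  then show False using min_sep_corner_contra[OF m f ab _ _ conjunct1[OF M]] aB pf by blast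
qed

lemma core_edge_at_min_side:
  assumes m: "min_sep x y A S B" and "{u, w} \<in> E" "u \<in> core" "w \<in> core" "u \<in> B"
  shows "u = y \<and> w = x"
proof -
  have "{u, w} = {x, y}" using core_edge_not_touching_min_side[OF m] assms by blast
  moreover have "u \<noteq> x" using edge_sep_parts[OF min_sepD(1)[OF m]] assms by blast
  ultimately show ?thesis by (auto simp: doubleton_eq_iff)
qed

section \<open>How a smallest side lies in the separations of other forest edges\<close>

context
  fixes x y A S B
  assumes m: "min_sep x y A S B"
begin

lemma min_corner_contra:
  assumes f: "edge_sep a b P T Q" and ab: "a \<in> core" "b \<in> core" "{a, b} \<noteq> {x, y}"
    and BP: "B \<inter> P \<noteq> {}" and xQ: "x \<notin> Q" and yQ: "y \<notin> Q"
    and M: "k \<le> card (B \<inter> T) + card (S \<inter> T) + card (S \<inter> P)"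
  shows False
proof -
  note e = min_sepD(1)[OF m]
  note pe = edge_sep_parts[OF e] and pf = edge_sep_parts[OF f]
  have aB: "a \<notin> B" using core_edge_not_touching_min_side[OF m] pf ab by blast
  have "A \<inter> Q = {}"
  proof (rule ccontr)
    assume AQ: "A \<inter> Q \<noteq> {}"
    have "k \<le> card (border A S Q T \<union> {a})"
      by (rule corner_boundary_ge[OF edge_sep_swap[OF e] edge_sep_swap[OF f] AQ, of _ y])
        (use aB xQ pe pf in auto)
    also have "\<dots> \<le> card (A \<inter> T) + card (S \<inter> T) + card (S \<inter> Q) + card {a}"
      by (rule card_border_le)
    finally show False using M edge_sep_cards(2,4)[OF e f] k2 by simp
  qed
  from min_sep_corner_contra[OF m f ab(1,2) BP this] M show False by linarith
qed

text \<open>Otherwise \<open>B \<inter> P\<close> is a smaller candidate for the far side of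
  \<open>xy\<close>. By minimality its border has \<open>k\<close> vertices, which
  \<open>min_corner_contra\<close> rules out.\<close>

lemma min_side_not_split:
  assumes f: "edge_sep a b P T Q" and ab: "a \<in> core" "b \<in> core" "{a, b} \<noteq> {x, y}"
    and y: "y \<in> P"
  shows "B \<subseteq> P"
proof (rule ccontr)
  assume BP: "\<not> B \<subseteq> P"
  note e = min_sepD(1)[OF m]
  note pe = edge_sep_parts[OF e] and pf = edge_sep_parts[OF f]
  note fin = edge_sep_finite[OF e]
  have aB: "a \<notin> B" using core_edge_not_touching_min_side[OF m] pf ab by blast
  obtain r where r: "r \<in> A" "r \<noteq> x"
    using other_vertex[OF card_far_side_ge[OF edge_sep_swap[OF e] min_sepD(2)[OF m]]] by blast
  have "B \<inter> P \<subset> B" using BP by blast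
  then have proper: "\<not> card B \<le> card (B \<inter> P)"
    using psubset_card_mono[OF fin(3)] by (simp add: not_le)
  have "k \<le> card (border B S P T \<union> {}) \<or>
      edge_sep x y (V - B \<inter> P - (border B S P T \<union> {})) (border B S P T \<union> {}) (B \<inter> P)"
    by (rule corner_sep[OF e f y, of _ r]) (use aB r in blast)+
  then have "k \<le> card (border B S P T \<union> {})"
    using min_sep_le[OF m] min_sepD[OF m] proper by blast
  then have M: "k \<le> card (B \<inter> T) + card (S \<inter> T) + card (S \<inter> P)"
    using card_border_le[of B S P T "{}"] by simp
  have "x \<notin> Q"
    using edge_sep_crossing[OF f, of y x] y pe ab(3) by (auto simp: insert_commute)
  then show False using min_corner_contra[OF f ab _ _ _ M] y pe pf by blast
qed

text \<open>Neither \<open>y\<close> nor \<open>a\<close> is in the corner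
  \<open>B \<inter> P\<close>, so no crossing edge leaves it and its border alone has
  \<open>k\<close> vertices. Then \<open>min_corner_contra\<close> leaves only
  \<open>x \<in> Q\<close>.\<close>

lemma min_side_corner_empty:
  assumes f: "edge_sep a b P T Q" and ab: "a \<in> core" "b \<in> core" "{a, b} \<noteq> {x, y}"
    and y: "y \<in> T" and BP: "B \<inter> P \<noteq> {}"
  shows "x \<in> Q" "k \<le> card (B \<inter> T) + card (S \<inter> T) + card (S \<inter> P)"
proof -
  note e = min_sepD(1)[OF m]
  note pe = edge_sep_parts[OF e] and pf = edge_sep_parts[OF f]
  have aB: "a \<notin> B" using core_edge_not_touching_min_side[OF m] pf ab by blast
  have "k \<le> card (border B S P T \<union> {})"
    by (rule corner_boundary_ge[OF e f BP, of _ x]) (use aB y pe pf in auto)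
  then show M: "k \<le> card (B \<inter> T) + card (S \<inter> T) + card (S \<inter> P)"
    using card_border_le[of B S P T "{}"] by simp
  show "x \<in> Q" using min_corner_contra[OF f ab BP _ _ M] y pf by blast
qed

text \<open>Here the corner \<open>A \<inter> P\<close> is so poorly attached that it can replace the side \<open>P\<close>, and its border
  meets \<open>B\<close> in \<open>y\<close> only.\<close>

lemma min_side_shift:
  assumes f: "edge_sep a b P T Q" and ab: "a \<in> core" "b \<in> core" "{a, b} \<noteq> {x, y}"
    and y: "y \<in> T" and BQ: "B \<inter> Q \<noteq> {}"
  shows "\<exists>C D W. edge_sep a b C D W \<and> (B - {y}) \<inter> D = {}"
proof -
  note e = min_sepD(1)[OF m]
  note pe = edge_sep_parts[OF e] and pf = edge_sep_parts[OF f]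
  have ba: "{b, a} \<noteq> {x, y}" "{b, a} \<in> E" using ab pf by (auto simp: insert_commute)
  have bB: "b \<notin> B" using core_edge_not_touching_min_side[OF m ba(2) ab(2,1) ba(1)] .
  note c = min_side_corner_empty[OF edge_sep_swap[OF f] ab(2,1) ba(1) y BQ]
  \<comment> \<open>The border of the opposite corner \<open>B \<inter> Q\<close> has at least
    \<open>k\<close> vertices, so at most \<open>k - 2\<close> remain here. Adding \<open>y\<close>,
    which blocks \<open>xy\<close>, is still affordable.\<close>
  have small: "card (border P T A S \<union> {y}) < k"
    using card_border_le[of A S P T "{y}"] c(2) edge_sep_cards(2,4)[OF e f] k2
    by (simp add: border_commute[of P])
  obtain r where r: "r \<in> B \<inter> Q" using BQ by blast
  have "a \<in> A"
  proof (rule ccontr)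
    assume "a \<notin> A"
    then have "k \<le> card (border P T A S \<union> {y})"
      by (intro corner_boundary_ge[OF edge_sep_swap[OF f] e, of _ r])
        (use c r y pe pf in auto)
    then show False using small by simp
  qed
  then have "k \<le> card (border P T A S \<union> {y}) \<or>
      edge_sep b a (V - P \<inter> A - (border P T A S \<union> {y})) (border P T A S \<union> {y}) (P \<inter> A)"
    by (rule corner_sep[OF edge_sep_swap[OF f] e, of _ r])
      (use c r y bB pe pf in auto)
  then have "edge_sep a b (P \<inter> A) (border P T A S \<union> {y}) (V - P \<inter> A - (border P T A S \<union> {y}))"
    using small edge_sep_swap by auto
  moreover have "(B - {y}) \<inter> (border P T A S \<union> {y}) = {}"
    using pe by (auto simp: border_def)
  ultimately show ?thesis by blast
qed

text \<open>Since \<open>B\<close> uses up part of \<open>T\<close>, the border of the corner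
  \<open>A \<inter> Q\<close> is short, and \<open>S \<inter> Q\<close> must make up for it. If that
  corner is empty, minimality compares \<open>B\<close> with \<open>Q \<subseteq> S\<close>.\<close>

lemma min_side_inside_separator:
  assumes f: "edge_sep a b P T Q" and ab: "a \<in> core" "b \<in> core" "{a, b} \<noteq> {x, y}"
    and BT: "B \<subseteq> T"
  shows "card B \<le> card (S \<inter> Q) + (if x \<in> Q then 1 else 0)"
proof (cases "A \<inter> Q = {}")
  case True
  have "B \<inter> Q = {}" using BT edge_sep_parts[OF f] by blast
  then show ?thesis
    using True edge_sep_cards(6)[OF min_sepD(1)[OF m] f] min_sep_le[OF m f ab(1,2)] by simp
next
  case False
  note e = min_sepD(1)[OF m]
  note pe = edge_sep_parts[OF e] and pf = edge_sep_parts[OF f]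
  have aB: "a \<notin> B" using core_edge_not_touching_min_side[OF m] pf ab by blast
  obtain r where r: "r \<in> B" "r \<noteq> y"
    using other_vertex[OF card_far_side_ge[OF e min_sepD(3)[OF m]]] by blast
  let ?Z = "insert a (if x \<in> Q then {y} else {})"
  have "k \<le> card (border A S Q T \<union> ?Z)"
    by (rule corner_boundary_ge[OF edge_sep_swap[OF e] edge_sep_swap[OF f] False, of _ r])
      (use aB r pe pf in \<open>auto split: if_splits\<close>)
  also have "\<dots> \<le> card (A \<inter> T) + card (S \<inter> T) + card (S \<inter> Q) + card ?Z"
    by (rule card_border_le)
  also have "card ?Z \<le> 1 + (if x \<in> Q then 1 else 0)" by (simp add: card_insert_if)
  finally have "k \<le> card (A \<inter> T) + card (S \<inter> T) + card (S \<inter> Q) + (1 + (if x \<in> Q then 1 else 0))"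
    by simp
  moreover have "B \<inter> T = B" using BT by blast
  ultimately show ?thesis using edge_sep_cards(2,4)[OF e f] by simp
qed

lemma small_min_side_or_avoiding:
  assumes edge: "{a, b} \<in> E" and ab: "a \<in> core" "b \<in> core"
  shows "2 * card B \<le> k \<or> (\<exists>C D W. edge_sep a b C D W \<and> (B - {y}) \<inter> D = {})"
proof (cases "{a, b} = {x, y}")
  case True
  note e = min_sepD(1)[OF m]
  have "S \<inter> B = {}" using edge_sep_parts[OF e] by blast
  moreover have "edge_sep a b A S B \<or> edge_sep a b B S A"
    using True e edge_sep_swap[OF e] by (auto simp: doubleton_eq_iff)
  ultimately show ?thesis by blast
next
  case ne: False
  then have ne': "{b, a} \<noteq> {x, y}" by (simp add: insert_commute)
  obtain P T Q where f: "edge_sep a b P T Q" using ex_edge_sep edge by blast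
  note f' = edge_sep_swap[OF f]
  note pf = edge_sep_parts[OF f] and pe = edge_sep_parts[OF min_sepD(1)[OF m]]
  consider "y \<in> P" | "y \<in> Q" | "y \<in> T" using pe(1,7) pf(1) by blast
  then show ?thesis
  proof cases
    case 1
    then have "B \<subseteq> P" using min_side_not_split[OF f ab ne] by blast
    then have "(B - {y}) \<inter> T = {}" using pf(2) by blast
    then show ?thesis using f by blast
  next
    case 2
    then have "B \<subseteq> Q" using min_side_not_split[OF f' ab(2,1) ne'] by blast
    then have "(B - {y}) \<inter> T = {}" using pf(4) by blast
    then show ?thesis using f by blast
  next
    case 3
    consider "B \<subseteq> T" | "B \<inter> P \<noteq> {}" | "B \<inter> Q \<noteq> {}" using pe(1) pf(1) by blast
    then show ?thesis
    proof cases
      case 1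
      have "\<not> (x \<in> P \<and> x \<in> Q)" using pf(3) by blast
      \<comment> \<open>Adding the bounds for \<open>P\<close> and \<open>Q\<close> gives
        \<open>2 * card B \<le> (k - 1) + 1\<close>, as \<open>x\<close> counts for one side at
        most.\<close>
      then show ?thesis
        using min_side_inside_separator[OF f ab ne 1] min_side_inside_separator[OF f' ab(2,1) ne' 1]
          edge_sep_cards(2)[OF min_sepD(1)[OF m] f] k2 by (auto split: if_splits)
    next
      case 2
      then show ?thesis
        using min_side_shift[OF f' ab(2,1) ne' 3] edge_sep_swap by blast
    next
      case splitQ: 3
      then show ?thesis using min_side_shift[OF f ab ne 3 splitQ] by blast
    qed
  qed
qed

section \<open>Counting around a small smallest side\<close>

text \<open>The only neighbour of \<open>y\<close> in \<open>core\<close> is \<open>x\<close>. Hence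
  at least \<open>k\<close> neighbours lie in \<open>V\<^sub>k\<close> within
  \<open>B \<union> S\<close>, while \<open>S\<close> has only \<open>k - 1\<close>
  vertices.\<close>

lemma card_Vdeg_min_side: "card (S \<inter> core) < card (B \<inter> Vdeg k V E)"
proof -
  note e = min_sepD(1)[OF m]
  note pe = edge_sep_parts[OF e] and fin = edge_sep_finite[OF e]
  let ?J = "B \<inter> Vdeg k V E" and ?K = "S \<inter> Vdeg k V E"
  have "nbrs y \<subseteq> ?J \<union> ?K \<union> {x}"
  proof
    fix w assume w: "w \<in> nbrs y"
    then have w': "w \<in> V" "{y, w} \<in> E" "{w, y} \<in> E"
      using nbrs_subset[of y] by (auto simp: nbrs_def insert_commute)
    show "w \<in> ?J \<union> ?K \<union> {x}"
    proof (cases "w \<in> core")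
      case True
      then show ?thesis
        using core_edge_at_min_side[OF m w'(2) min_sepD(3)[OF m] _ pe(7)] by blast
    next
      case False
      then have "w \<in> Vdeg k V E" using w' by (simp add: Vdeg_iff)
      moreover have "w \<in> B \<union> S \<union> {x}" using edge_sep_crossing[OF e w'(3)] pe(1,7) w'(1) by blast
      ultimately show ?thesis by blast
    qed
  qed
  then have "card (nbrs y) \<le> card (?J \<union> ?K \<union> {x})" using fin by (intro card_mono) auto
  also have "\<dots> \<le> card (?J \<union> ?K) + card {x}" by (rule card_Un_le)
  also have "card (?J \<union> ?K) \<le> card ?J + card ?K" by (rule card_Un_le)
  finally have "k \<le> card ?J + card ?K"
    using min_sepD(3)[OF m] by (simp add: core_iff degree_eq_card_nbrs)
  moreover have "card (S \<inter> core) + card ?K = k - 1"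
  proof -
    have "S = S \<inter> core \<union> ?K" using pe(1) Vdeg_iff by blast
    then have "card S = card (S \<inter> core \<union> ?K)" by simp
    also have "\<dots> = card (S \<inter> core) + card ?K"
      using fin by (intro card_Un_disjoint) (auto simp: Vdeg_iff)
    finally show ?thesis using pe(5) by simp
  qed
  ultimately show ?thesis using k2 by linarith
qed

text \<open>No forest edge but \<open>xy\<close> meets \<open>B\<close>, so these vertices are
  isolated in \<open>F\<close>; the component of \<open>y\<close> is one more.\<close>

lemma card_min_side_core_le: "Suc (card ((B - {y}) \<inter> core)) \<le> cF k V E"
proof -
  note pe = edge_sep_parts[OF min_sepD(1)[OF m]] and fin = edge_sep_finite[OF min_sepD(1)[OF m]]
  let ?I = "(B - {y}) \<inter> core"
  have isolated: "b = a" if "(a, b) \<in> (adj_in core E)\<^sup>*" "a \<in> ?I" for a b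
    using that(1)
  proof (cases rule: converse_rtranclE)
    case (step c)
    then show ?thesis
      using core_edge_at_min_side[OF m, of a c] that(2) by (auto simp: adj_in_def)
  qed simp
  have "card (insert y ?I) \<le> card (components_in core E)"
  proof (rule card_le_components)
    show "a = b" if "a \<in> insert y ?I" "b \<in> insert y ?I" "(a, b) \<in> (adj_in core E)\<^sup>*" for a b
      using isolated[OF that(3)] isolated[OF adj_in_rtrancl_sym[OF that(3)]] that by blast
  qed (use finite_core min_sepD(3)[OF m] in auto)
  then show ?thesis using fin by (simp add: cF_def core_def)
qed

lemma bound_if_small_min_side:
  assumes small: "2 * card B \<le> k"
  shows "k \<le> cF k V E + card (Edeg k V E)"
proof -
  note e = min_sepD(1)[OF m]
  note pe = edge_sep_parts[OF e] and fin = edge_sep_finite[OF e]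
  let ?W = "Vdeg k V E"
  let ?I = "(B - {y}) \<inter> core" and ?J = "B \<inter> ?W" and ?s = "card (S \<inter> core)"
  have cB: "card B = Suc (card ?I + card ?J)"
  proof -
    have "B \<subseteq> V" using pe(1) by blast
    then have "B = insert y (?I \<union> ?J)" using pe(7) Vdeg_iff by blast
    moreover have "y \<notin> ?I \<union> ?J" using min_sepD(3)[OF m] by (auto simp: Vdeg_iff)
    moreover have "card (?I \<union> ?J) = card ?I + card ?J"
      using fin by (intro card_Un_disjoint) (auto simp: Vdeg_iff)
    ultimately show ?thesis using fin by (metis card_insert_disjoint finite_Int finite_Diff finite_UnI)
  qed
  have many: "k \<le> card (nbrs v \<inter> ?W) + card ?I + 1 + ?s" if v: "v \<in> ?J" for v
  proof -
    have v': "v \<noteq> y" "degree E v = k"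
      using v min_sepD(3)[OF m] by (auto simp: core_def Vdeg_def)
    have "nbrs v \<inter> core \<subseteq> ?I \<union> {y} \<union> (S \<inter> core)"
      using edge_sep_crossing[OF e, of _ v] v v' pe(1) nbrs_subset[of v]
      by (auto simp: nbrs_def insert_commute)
    then have "card (nbrs v \<inter> core) \<le> card (?I \<union> {y} \<union> (S \<inter> core))"
      using fin by (intro card_mono) auto
    also have "\<dots> \<le> card (?I \<union> {y}) + ?s" by (rule card_Un_le)
    also have "card (?I \<union> {y}) \<le> card ?I + card {y}" by (rule card_Un_le)
    finally show ?thesis using card_nbrs_split[of v] v' by simp
  qed
  note J = card_Vdeg_min_side
  then obtain v where v: "v \<in> ?J" by (cases "?J = {}") auto
  \<comment> \<open>Otherwise \<open>k \<le> card B + ?s\<close>, but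
    \<open>?s < card ?J < card B\<close> and \<open>2 * card B \<le> k\<close>.\<close>
  have "\<exists>u. u \<in> nbrs w \<inter> ?W - ?J" if w: "w \<in> ?J" for w
  proof (rule ccontr)
    assume "\<not> ?thesis"
    then have "nbrs w \<inter> ?W \<subseteq> ?J" by blast
    then have "card (nbrs w \<inter> ?W) \<le> card ?J" using fin by (intro card_mono) auto
    then show False using many[OF w] small cB J by linarith
  qed
  then obtain g where g: "\<And>w. w \<in> ?J \<Longrightarrow> g w \<in> nbrs w \<inter> ?W - ?J" by metis
  \<comment> \<open>All edges of \<open>E\<^sub>k\<close> at \<open>v\<close>, and one edge leaving
    \<open>?J\<close> for every other vertex of \<open>?J\<close>; the latter make up for the loss
    of \<open>?s\<close> in \<open>many\<close>.\<close>
  let ?E1 = "(\<lambda>w. {v, w}) ` (nbrs v \<inter> ?W)" and ?E2 = "(\<lambda>w. {w, g w}) ` (?J - {v})"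
  have "card ?E1 = card (nbrs v \<inter> ?W)"
    by (intro card_image) (auto simp: inj_on_def doubleton_eq_iff)
  moreover have "card ?E2 = card (?J - {v})"
  proof (intro card_image inj_onI)
    fix w w' assume w: "w \<in> ?J - {v}" "w' \<in> ?J - {v}" "{w, g w} = {w', g w'}"
    then have "g w \<noteq> w'" using g[of w] by blast
    then show "w = w'" using w(3) by (auto simp: doubleton_eq_iff)
  qed
  moreover have "?E1 \<inter> ?E2 = {}"
  proof -
    have "v \<notin> {w, g w}" if "w \<in> ?J - {v}" for w using g[of w] that v by blast
    then show ?thesis by blast
  qed
  moreover have "?E1 \<union> ?E2 \<subseteq> Edeg k V E"
    using v g by (auto simp: Edeg_def nbrs_def)
  then have "card (?E1 \<union> ?E2) \<le> card (Edeg k V E)"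
    using finite_E by (intro card_mono) (auto simp: Edeg_def)
  moreover have "card (?E1 \<union> ?E2) = card ?E1 + card ?E2"
    by (rule card_Un_disjoint) (use fin finite_nbrs \<open>?E1 \<inter> ?E2 = {}\<close> in auto)
  moreover have "card (?J - {v}) = card ?J - 1" using v fin by simp
  ultimately show ?thesis using many[OF v] J card_min_side_core_le by linarith
qed

end

lemma core_components_bound: "k \<le> cF k V E + card (Edeg k V E)"
proof (cases "\<exists>p q. {p, q} \<in> E \<and> p \<in> core \<and> q \<in> core")
  case True
  then obtain x y A S B where m: "min_sep x y A S B" using ex_min_sep by blast
  show ?thesis
  proof (cases "2 * card B \<le> k")
    case True then show ?thesis by (rule bound_if_small_min_side[OF m])
  next
    case False
    obtain v where v: "v \<in> B" "v \<in> Vdeg k V E"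
      using card_Vdeg_min_side[OF m] by (cases "B \<inter> Vdeg k V E = {}") auto
    then have "v \<in> B - {y}" using min_sepD(3)[OF m] by (auto simp: Vdeg_iff)
    then show ?thesis
      using small_min_side_or_avoiding[OF m] False by (intro bound_if_avoiding[OF v(2)]) blast
  qed
next
  case False
  have "Vdeg k V E \<noteq> {}"
  proof
    assume empty: "Vdeg k V E = {}"
    obtain v where v: "v \<in> V" using card_V by fastforce
    then have "degree E v > 0" using degree_ge[OF v] k2 by simp
    then obtain w where vw: "{v, w} \<in> E"
      by (auto simp: degree_eq_card_nbrs nbrs_def card_gt_0_iff)
    moreover have "core = V" using empty by (simp add: core_def)
    ultimately show False using False edge_in_V by metis
  qed
  \<comment> \<open>Without forest edges the avoidance condition is vacuous, so any vertex of
    \<open>V\<^sub>k\<close> will do.\<close>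
  then obtain v where "v \<in> Vdeg k V E" by blast
  then show ?thesis by (rule bound_if_avoiding) (use False in blast)
qed

end

text \<open>The equation is \<open>edge_count\<close> solved over the reals;
  \<open>core_components_bound\<close> and the integrality of the count give the rounded
  bound.\<close>

theorem mainTheorem2:
  fixes V :: "'a set" and E :: "'a set set" and k :: nat
  assumes "simple_graph V E"
    and "k \<ge> 2"
    and "minimally_k_connected k V E"
  shows "real (card (Vdeg k V E)) =
           (real (card E) - real (card V) + real (cF k V E) + real (card (Edeg k V E)))
             / (real k - 1)
       \<and> real (card (Vdeg k V E)) \<ge>
           real_of_int \<lceil>(real (card E) - real (card V) + real k) / (real k - 1)\<rceil>"
proof -
  interpret minimally_k_connected_graph V E k using assms by unfold_locales
  let ?t = "card (Vdeg k V E)"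
  have "real (card E + card (Edeg k V E) + cF k V E + ?t) = real (card V + k * ?t)"
    using edge_count by (rule arg_cong)
  then have eq: "real ?t * (real k - 1)
      = real (card E) - real (card V) + real (cF k V E) + real (card (Edeg k V E))"
    by (simp add: algebra_simps)
  have pos: "real k - 1 > 0" using assms(2) by simp
  have "real k \<le> real (cF k V E) + real (card (Edeg k V E))"
    using core_components_bound by (simp flip: of_nat_add)
  then have "(real (card E) - real (card V) + real k) / (real k - 1) \<le> real ?t"
    using eq pos by (simp add: pos_divide_le_eq)
  then have "\<lceil>(real (card E) - real (card V) + real k) / (real k - 1)\<rceil> \<le> int ?t"
    by (simp add: ceiling_le_iff)
  then have "real_of_int \<lceil>(real (card E) - real (card V) + real k) / (real k - 1)\<rceil> \<le> real ?t"
    by linarith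
  then show ?thesis using eq pos by (simp add: eq_divide_eq)
qed

end
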